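(* Let $G$ be a finite group, $N$ a normal subgroup of $G$, and $\chi_1,\dots,\chi_k$ all the irreducible complex characters of $G$. Let $\Pi$ be the character of the complex permutation representation of $G$ arising from the left multiplication action of $G$ on $G/N$. For $g\in G$ let $O_N(g)$ be the order of the image of $g$ in $G/N$. Let $m\ge 1$ be an integer. Then: (1) For every $g\in G$, $$\lambda_t(m\Pi)(g)=\bigl(1-(-t)^{O_N(g)}\bigr)^{\frac{m|G/N|}{O_N(g)}},\qquad S_t(m\Pi)(g)=\bigl(1-t^{O_N(g)}\bigr)^{-\frac{m|G/N|}{O_N(g)}}.$$ (2) For every $j=1,\dots,k$, $$\langle \chi_j,S_t(m\Pi)\rangle_G=\frac{1}{|G|}\sum_{g\in G}\chi_j(g)\bigl(1-t^{O_N(g)}\bigr)^{-\frac{m|G/N|}{O_N(g)}},$$ $$\langle \chi_j,\lambda_t(m\Pi)\rangle_G=\frac{1}{|G|}\sum_{g\in G}\chi_j(g)\bigl(1-(-t)^{O_N(g)}\bigr)^{\frac{m|G/N|}{O_N(g)}}.$$ (3) In particular, if $n\ge 1$ satisfies $\gcd(n,|G/N|)=1$, then $$S^n(m\Pi)=\frac{1}{|G/N|}\binom{m|G/N|+n-1}{n}\Pi,\qquad \lambda^n(m\Pi)=\frac{1}{|G/N|}\binom{m|G/N|}{n}\Pi .$$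
   Context: For a finite group $G$, $\mathrm{Map}(G,\mathbb{C})$ is the commutative $\mathbb{C}$-algebra of all functions $G\to\mathbb{C}$ with pointwise operations. Adams operations: $\psi^n(f)(g)=f(g^n)$ for $n\ge1$. The $\lambda$-operations $\lambda^i$ ($i\ge 0$) on $\mathrm{Map}(G,\mathbb{C})$ are defined by letting $\lambda_t(f)=\sum_{i\ge0}\lambda^i(f)t^i$ be the unique formal power series over $\mathrm{Map}(G,\mathbb{C})$ with constant term $1$ satisfying $\sum_{n\ge1}\psi^n(f)(-t)^n=-t\,\bigl(\tfrac{d}{dt}\lambda_t(f)\bigr)\lambda_t(f)^{-1}$. The symmetric power operations $S^i$ are defined by $S_t(f)=\sum_{i\ge0}S^i(f)t^i=(\lambda_{-t}(f))^{-1}$. (If $\chi$ is the character of a finite-dimensional complex representation $V$, then $\lambda^i(\chi)$ and $S^i(\chi)$ are the characters of $\bigwedge^i V$ and $S^i(V)$.) For $g\in G$, $\lambda_t(f)(g)=\sum_i\lambda^i(f)(g)t^i\in\mathbb{C}[[t]]$, and similarly for $S_t(f)(g)$. Inner product: $\langle f,f'\rangle_G=\frac1{|G|}\sum_{g\in G}f(g)f'(g^{-1})$, and $\langle\chi_j,S_t(\chi)\rangle_G=\sum_{i\ge0}\langle\chi_j,S^i(\chi)\rangle_Gt^i$, $\langle\chi_j,\lambda_t(\chi)\rangle_G=\sum_{i\ge0}\langle\chi_j,\lambda^i(\chi)\rangle_Gt^i$. Powers of series are binomial series: $(1+t)^r=\sum_{i\ge0}\binom{r}{i}t^i$ with $\binom{r}{i}=r(r-1)\cdots(r-i+1)/i!$,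 with a series of zero constant term substituted for $t$. *)

theory Defs
  imports
    "HOL-Algebra.Multiplicative_Group"
    "HOL-Algebra.Group_Action"
    "HOL-Library.Function_Algebras"
    "HOL-Library.Indicator_Function"
    "HOL-Computational_Algebra.Formal_Power_Series"
    "Jordan_Normal_Form.VS_Connect"
begin

section \<open>Complex matrix representations and characters\<close>

definition representation :: "('a, 'b) monoid_scheme \<Rightarrow> nat \<Rightarrow> ('a \<Rightarrow> complex mat) \<Rightarrow> bool" where
  "representation G n \<rho> \<longleftrightarrow>
     (\<forall>g \<in> carrier G. \<rho> g \<in> carrier_mat n n) \<and>
     \<rho> \<one>\<^bsub>G\<^esub> = 1\<^sub>m n \<and>
     (\<forall>g \<in> carrier G. \<forall>h \<in> carrier G. \<rho> (g \<otimes>\<^bsub>G\<^esub> h) = \<rho> g * \<rho> h)"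

definition irreducible_representation ::
    "('a, 'b) monoid_scheme \<Rightarrow> nat \<Rightarrow> ('a \<Rightarrow> complex mat) \<Rightarrow> bool" where
  "irreducible_representation G n \<rho> \<longleftrightarrow>
     representation G n \<rho> \<and> n \<noteq> 0 \<and>
     (\<forall>W. VectorSpace.subspace class_ring W (module_vec TYPE(complex) n) \<longrightarrow>
          (\<forall>g \<in> carrier G. \<forall>w \<in> W. \<rho> g *\<^sub>v w \<in> W) \<longrightarrow>
          W = {0\<^sub>v n} \<or> W = carrier_vec n)"

text \<open>
  The algebra of complex functions on the group is modelled by the functions of type
  \<open>'a \<Rightarrow> complex\<close> that vanish outside \<open>carrier G\<close>. With the pointwise operations of
  \<^theory>\<open>HOL-Library.Function_Algebras\<close> these are closed under addition and multiplication;
  the unit element of the algebra is \<open>indicator (carrier G)\<close>, not the constant function \<open>1\<close>.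
\<close>

definition functions_on :: "('a, 'b) monoid_scheme \<Rightarrow> ('a \<Rightarrow> complex) set" where
  "functions_on G = {f. \<forall>g. g \<notin> carrier G \<longrightarrow> f g = 0}"

definition rep_character :: "('a, 'b) monoid_scheme \<Rightarrow> ('a \<Rightarrow> complex mat) \<Rightarrow> 'a \<Rightarrow> complex" where
  "rep_character G \<rho> =
     (\<lambda>g. if g \<in> carrier G then (\<Sum>i<dim_row (\<rho> g). \<rho> g $$ (i, i)) else 0)"

definition irreducible_characters :: "('a, 'b) monoid_scheme \<Rightarrow> ('a \<Rightarrow> complex) set" where
  "irreducible_characters G =
     {rep_character G \<rho> | n \<rho>. irreducible_representation G n \<rho>}"

text \<open>
  The permutation representation attached to an action \<open>\<phi>\<close> on a set with \<open>d\<close> elements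
  \<open>e 0, \<dots>, e (d - 1)\<close>, written as matrices in the basis given by this enumeration:
  column \<open>j\<close> is the basis vector of \<open>\<phi> g (e j)\<close>.
\<close>

definition permutation_rep :: "nat \<Rightarrow> (nat \<Rightarrow> 'x) \<Rightarrow> ('a \<Rightarrow> 'x \<Rightarrow> 'x) \<Rightarrow> 'a \<Rightarrow> complex mat" where
  "permutation_rep d e \<phi> = (\<lambda>g. mat d d (\<lambda>(i, j). if \<phi> g (e j) = e i then 1 else 0))"

text \<open>
  For normal \<open>N\<close> the right cosets forming \<open>carrier (G Mod N)\<close> are also the left cosets, and
  \<open>g <# (a <# N) = (g \<otimes> a) <# N\<close>.
\<close>

definition coset_action :: "('a, 'b) monoid_scheme \<Rightarrow> 'a set \<Rightarrow> 'a \<Rightarrow> 'a set \<Rightarrow> 'a set" where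
  "coset_action G N = (\<lambda>g. \<lambda>C \<in> carrier (G Mod N). g <#\<^bsub>G\<^esub> C)"

definition char_inner ::
    "('a, 'b) monoid_scheme \<Rightarrow> ('a \<Rightarrow> complex) \<Rightarrow> ('a \<Rightarrow> complex) \<Rightarrow> complex" where
  "char_inner G f f' =
     1 / of_nat (card (carrier G)) * (\<Sum>g \<in> carrier G. f g * f' (inv\<^bsub>G\<^esub> g))"


section \<open>Adams, exterior and symmetric power operations\<close>

definition adams :: "('a, 'b) monoid_scheme \<Rightarrow> nat \<Rightarrow> ('a \<Rightarrow> complex) \<Rightarrow> 'a \<Rightarrow> complex" where
  "adams G n f = (\<lambda>g. if g \<in> carrier G then f (g [^]\<^bsub>G\<^esub> n) else 0)"

definition series_on :: "('a, 'b) monoid_scheme \<Rightarrow> ('a \<Rightarrow> complex) fps set" where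
  "series_on G = {F. \<forall>i. fps_nth F i \<in> functions_on G}"

definition one_series :: "('a, 'b) monoid_scheme \<Rightarrow> ('a \<Rightarrow> complex) fps" where
  "one_series G = fps_const (indicator (carrier G))"

definition series_inverse ::
    "('a, 'b) monoid_scheme \<Rightarrow> ('a \<Rightarrow> complex) fps \<Rightarrow> ('a \<Rightarrow> complex) fps" where
  "series_inverse G F = (THE H. H \<in> series_on G \<and> F * H = one_series G)"

definition adams_series ::
    "('a, 'b) monoid_scheme \<Rightarrow> ('a \<Rightarrow> complex) \<Rightarrow> ('a \<Rightarrow> complex) fps" where
  "adams_series G f = Abs_fps (\<lambda>n. if n = 0 then 0 else (- 1) ^ n * adams G n f)"

definition lambda_series ::
    "('a, 'b) monoid_scheme \<Rightarrow> ('a \<Rightarrow> complex) \<Rightarrow> ('a \<Rightarrow> complex) fps" where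
  "lambda_series G f =
     (THE L. L \<in> series_on G \<and> fps_nth L 0 = indicator (carrier G) \<and>
             adams_series G f = - fps_X * fps_deriv L * series_inverse G L)"

definition symmetric_series ::
    "('a, 'b) monoid_scheme \<Rightarrow> ('a \<Rightarrow> complex) \<Rightarrow> ('a \<Rightarrow> complex) fps" where
  "symmetric_series G f = series_inverse G (lambda_series G f oo (- fps_X))"

definition lambda_op ::
    "('a, 'b) monoid_scheme \<Rightarrow> nat \<Rightarrow> ('a \<Rightarrow> complex) \<Rightarrow> 'a \<Rightarrow> complex" where
  "lambda_op G i f = fps_nth (lambda_series G f) i"

definition symmetric_op ::
    "('a, 'b) monoid_scheme \<Rightarrow> nat \<Rightarrow> ('a \<Rightarrow> complex) \<Rightarrow> 'a \<Rightarrow> complex" where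
  "symmetric_op G i f = fps_nth (symmetric_series G f) i"

definition series_at :: "('a \<Rightarrow> complex) fps \<Rightarrow> 'a \<Rightarrow> complex fps" where
  "series_at F g = Abs_fps (\<lambda>i. fps_nth F i g)"

definition series_inner ::
    "('a, 'b) monoid_scheme \<Rightarrow> ('a \<Rightarrow> complex) \<Rightarrow> ('a \<Rightarrow> complex) fps \<Rightarrow> complex fps" where
  "series_inner G f F = Abs_fps (\<lambda>i. char_inner G f (fps_nth F i))"


section \<open>Well-definedness\<close>

lemma series_at_nth [simp]: "fps_nth (series_at F g) i = fps_nth F i g"
  by (simp add: series_at_def)

lemma series_at_eqI: "(\<And>g. series_at F g = series_at H g) \<Longrightarrow> F = H"
  by (metis (no_types, lifting) ext fps_ext series_at_nth)

lemma sum_fun_apply': "sum h A x = (\<Sum>i\<in>A. (h i :: 'a \<Rightarrow> complex) x)"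
  by (induction A rule: infinite_finite_induct) auto

lemma series_at_mult: "series_at (F * H) g = series_at F g * series_at H g"
  by (rule fps_ext) (simp add: fps_mult_nth sum_fun_apply')

lemma series_at_uminus: "series_at (- F) g = - series_at F g"
  by (rule fps_ext) simp

lemma series_at_X: "series_at fps_X g = fps_X"
  by (rule fps_ext) (simp add: fps_X_def)

lemma of_nat_fun_apply: "(of_nat n :: 'a \<Rightarrow> complex) x = of_nat n"
  by (induction n) auto

lemma series_at_deriv: "series_at (fps_deriv F) g = fps_deriv (series_at F g)"
  by (rule fps_ext) (simp add: of_nat_fun_apply del: of_nat_Suc of_nat_add)

lemma series_on_iff: "F \<in> series_on G \<longleftrightarrow> (\<forall>g. g \<notin> carrier G \<longrightarrow> series_at F g = 0)"
  by (auto simp: series_on_def functions_on_def fps_eq_iff)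

lemma series_at_one: "series_at (one_series G) g = (if g \<in> carrier G then 1 else 0)"
  by (rule fps_ext) (simp add: one_series_def)

lemma series_inverse_ex1:
  assumes "F \<in> series_on G" "fps_nth F 0 = indicator (carrier G)"
  shows "\<exists>!H. H \<in> series_on G \<and> F * H = one_series G"
proof
  define H where "H = Abs_fps (\<lambda>i g. if g \<in> carrier G then fps_nth (inverse (series_at F g)) i else 0)"
  have H: "series_at H g = (if g \<in> carrier G then inverse (series_at F g) else 0)" for g
    by (rule fps_ext) (simp add: H_def)
  have nz: "g \<in> carrier G \<Longrightarrow> fps_nth (series_at F g) 0 \<noteq> 0" for g
    using assms(2) by simp
  show "H \<in> series_on G \<and> F * H = one_series G"
    using nz by (auto simp: series_on_iff H series_at_mult series_at_one inverse_mult_eq_1'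
        intro!: series_at_eqI)
  fix K assume K: "K \<in> series_on G \<and> F * K = one_series G"
  show "K = H"
  proof (rule series_at_eqI)
    fix g
    show "series_at K g = series_at H g"
    proof (cases "g \<in> carrier G")
      case True
      then have "series_at F g * series_at K g = 1"
        using K series_at_mult[of F K g] by (simp add: series_at_one)
      with True nz show ?thesis by (simp add: H fps_inverse_unique)
    qed (use K in \<open>auto simp: H series_on_iff\<close>)
  qed
qed

lemma series_at_inverse:
  assumes "F \<in> series_on G" "fps_nth F 0 = indicator (carrier G)"
  shows "series_at (series_inverse G F) g = (if g \<in> carrier G then inverse (series_at F g) else 0)"
proof -
  from theI'[OF series_inverse_ex1[OF assms]]
  have *: "series_inverse G F \<in> series_on G" "F * series_inverse G F = one_series G"
    by (auto simp: series_inverse_def)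
  show ?thesis
  proof (cases "g \<in> carrier G")
    case True
    then have "series_at F g * series_at (series_inverse G F) g = 1"
      using *(2) series_at_mult[of F _ g] by (metis series_at_one)
    with True show ?thesis by (simp add: fps_inverse_unique)
  qed (use * in \<open>auto simp: series_on_iff\<close>)
qed

lemma lambda_series_ex1:
  "\<exists>!L. L \<in> series_on G \<and> fps_nth L 0 = indicator (carrier G) \<and>
        adams_series G f = - fps_X * fps_deriv L * series_inverse G L"
proof
  define p where "p g = fps_shift 1 (series_at (adams_series G f) g)" for g
  have P: "series_at (adams_series G f) g = fps_X * p g" for g
    by (rule fps_ext) (auto simp: p_def adams_series_def fps_X_mult_nth)
  have P0: "series_at (adams_series G f) g = 0" if "g \<notin> carrier G" for g
    using that by (intro fps_ext) (auto simp: adams_series_def adams_def)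
  have p0: "p g = 0" if "g \<notin> carrier G" for g
    by (simp add: p_def P0[OF that])
  define l where "l g = fps_exp 1 oo fps_integral0 (- p g)" for g
  define L where "L = Abs_fps (\<lambda>i g. if g \<in> carrier G then fps_nth (l g) i else 0)"
  have l0: "fps_nth (l g) 0 = 1" for g
    by (simp add: l_def fps_compose_nth)
  have l': "fps_deriv (l g) = - p g * l g" for g
    by (simp add: l_def fps_compose_deriv fps_deriv_fps_integral mult.commute)
  have L: "series_at L g = (if g \<in> carrier G then l g else 0)" for g
    by (rule fps_ext) (simp add: L_def)
  have L_on: "L \<in> series_on G" and L0: "fps_nth L 0 = indicator (carrier G)"
    by (auto simp: series_on_iff L) (auto simp: L_def l0 indicator_def fun_eq_iff)
  have "adams_series G f = - fps_X * fps_deriv L * series_inverse G L"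
  proof (rule series_at_eqI)
    fix g
    have "l g * inverse (l g) = 1" using l0[of g] by (simp add: inverse_mult_eq_1')
    then show "series_at (adams_series G f) g =
        series_at (- fps_X * fps_deriv L * series_inverse G L) g"
      by (cases "g \<in> carrier G")
        (simp_all add: series_at_mult series_at_uminus series_at_X series_at_deriv
           series_at_inverse[OF L_on L0] L l' p0 P mult.assoc)
  qed
  with L_on L0 show "L \<in> series_on G \<and> fps_nth L 0 = indicator (carrier G) \<and>
        adams_series G f = - fps_X * fps_deriv L * series_inverse G L" by blast
  fix K assume K: "K \<in> series_on G \<and> fps_nth K 0 = indicator (carrier G) \<and>
        adams_series G f = - fps_X * fps_deriv K * series_inverse G K"
  show "K = L"
  proof (rule series_at_eqI)
    fix g
    show "series_at K g = series_at L g"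
    proof (cases "g \<in> carrier G")
      case True
      define k where "k = series_at K g"
      have k0: "fps_nth k 0 = 1" using K True by (simp add: k_def)
      have inv: "inverse k * k = 1" using k0 by (simp add: inverse_mult_eq_1)
      from K have "fps_X * p g = series_at (- fps_X * fps_deriv K * series_inverse G K) g"
        using P by metis
      also have "\<dots> = fps_X * (- fps_deriv k * inverse k)"
        using K True by (simp add: series_at_mult series_at_uminus series_at_X series_at_deriv
           series_at_inverse k_def mult.assoc)
      finally have "p g = - fps_deriv k * inverse k"
        using fps_X_neq_zero mult_left_cancel by blast
      then have k': "fps_deriv k = - p g * k" using inv by (simp add: mult.assoc)
      have linv: "inverse (l g) * l g = 1" using l0[of g] by (simp add: inverse_mult_eq_1)
      have "fps_deriv (k * inverse (l g)) = 0"
        using l0[of g] linv by (simp add: fps_inverse_deriv k' l' power2_eq_square algebra_simps)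
      then have "k * inverse (l g) = fps_const (fps_nth (k * inverse (l g)) 0)"
        using fps_deriv_eq_0_iff by blast
      also have "\<dots> = 1" using k0 l0 by simp
      finally have "k = l g" using linv by (metis mult.assoc mult.right_neutral mult_1)
      with True show ?thesis by (simp add: L k_def)
    qed (use K in \<open>auto simp: L series_on_iff\<close>)
  qed
qed

lemma representation_permutation_rep:
  assumes "group_action G E \<phi>" and e: "bij_betw e {..<d} E"
  shows "representation G d (permutation_rep d e \<phi>)"
proof -
  interpret group_action G E \<phi> by fact
  have eE: "e i \<in> E" if "i < d" for i using e that by (auto simp: bij_betw_def)
  have inj: "e i = e j \<longleftrightarrow> i = j" if "i < d" "j < d" for i j
    using e that by (auto simp: bij_betw_def inj_on_def)
  have "permutation_rep d e \<phi> (g \<otimes>\<^bsub>G\<^esub> h) = permutation_rep d e \<phi> g * permutation_rep d e \<phi> h"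
    if gh: "g \<in> carrier G" "h \<in> carrier G" for g h
  proof (rule eq_matI)
    fix i j assume "i < dim_row (permutation_rep d e \<phi> g * permutation_rep d e \<phi> h)"
      "j < dim_col (permutation_rep d e \<phi> g * permutation_rep d e \<phi> h)"
    then have ij: "i < d" "j < d" by (auto simp: permutation_rep_def)
    have "\<phi> h (e j) \<in> E" using gh ij eE element_image by blast
    then obtain k where k: "k < d" "\<phi> h (e j) = e k" using e by (auto simp: bij_betw_def)
    have "(\<Sum>l<d. (if \<phi> g (e l) = e i then 1 else 0) * (if \<phi> h (e j) = e l then 1 else 0 :: complex))
        = (\<Sum>l<d. if l = k then (if \<phi> g (e l) = e i then 1 else 0) else 0)"
      using k inj by (intro sum.cong) auto
    also have "\<dots> = (if \<phi> g (e k) = e i then 1 else 0)" using k by simp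
    also have "\<phi> g (e k) = \<phi> (g \<otimes>\<^bsub>G\<^esub> h) (e j)"
      using composition_rule[OF eE[OF ij(2)] gh] k by simp
    finally show "permutation_rep d e \<phi> (g \<otimes>\<^bsub>G\<^esub> h) $$ (i, j) =
        (permutation_rep d e \<phi> g * permutation_rep d e \<phi> h) $$ (i, j)"
      using ij by (simp add: permutation_rep_def scalar_prod_def atLeast0LessThan)
  qed (auto simp: permutation_rep_def)
  moreover have "permutation_rep d e \<phi> \<one>\<^bsub>G\<^esub> = 1\<^sub>m d"
  proof -
    have "\<phi> \<one>\<^bsub>G\<^esub> (e j) = e j" if "j < d" for j
      using fun_cong[OF id_eq_one, of "e j"] eE[OF that] by simp
    then show ?thesis using inj by (intro eq_matI) (auto simp: permutation_rep_def)
  qed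
  ultimately show ?thesis by (auto simp: representation_def permutation_rep_def)
qed

lemma group_action_coset_action:
  assumes "N \<lhd> G"
  shows "group_action G (carrier (G Mod N)) (coset_action G N)"
proof -
  interpret normal N G by fact
  have E: "carrier (G Mod N) = {a <#\<^bsub>G\<^esub> N | a. a \<in> carrier G}"
    using coset_eq by (auto simp: FactGroup_def RCOSETS_def)
  have mult: "g <#\<^bsub>G\<^esub> (a <#\<^bsub>G\<^esub> N) = (g \<otimes>\<^bsub>G\<^esub> a) <#\<^bsub>G\<^esub> N" if "g \<in> carrier G" "a \<in> carrier G" for g a
    using that subset by (simp add: lcos_m_assoc)
  have cl: "g <#\<^bsub>G\<^esub> C \<in> carrier (G Mod N)" if "g \<in> carrier G" "C \<in> carrier (G Mod N)" for g C
    using that mult unfolding E by blast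
  have sub: "C \<subseteq> carrier G" if "C \<in> carrier (G Mod N)" for C
    using that subset unfolding E by (auto simp: l_coset_def)
  have assoc: "g <#\<^bsub>G\<^esub> (h <#\<^bsub>G\<^esub> C) = (g \<otimes>\<^bsub>G\<^esub> h) <#\<^bsub>G\<^esub> C"
    if "g \<in> carrier G" "h \<in> carrier G" "C \<in> carrier (G Mod N)" for g h C
    using that sub by (simp add: lcos_m_assoc)
  have one: "\<one>\<^bsub>G\<^esub> <#\<^bsub>G\<^esub> C = C" if "C \<in> carrier (G Mod N)" for C
    using that sub by (simp add: lcos_mult_one)
  have bij: "bij_betw (coset_action G N g) (carrier (G Mod N)) (carrier (G Mod N))"
    if "g \<in> carrier G" for g
    by (rule bij_betw_byWitness[where f' = "coset_action G N (inv\<^bsub>G\<^esub> g)"])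
      (use that in \<open>auto simp: coset_action_def cl assoc one\<close>)
  show ?thesis unfolding group_action_def group_hom_def group_hom_axioms_def
  proof (intro conjI group_BijGroup is_group homI)
    fix g h assume gh: "g \<in> carrier G" "h \<in> carrier G"
    show "coset_action G N g \<in> carrier (BijGroup (carrier (G Mod N)))"
      using bij[OF gh(1)] by (auto simp: BijGroup_def Bij_def coset_action_def)
    have "coset_action G N (g \<otimes>\<^bsub>G\<^esub> h) =
        compose (carrier (G Mod N)) (coset_action G N g) (coset_action G N h)"
      using gh by (auto simp: coset_action_def compose_def fun_eq_iff cl assoc)
    moreover have "coset_action G N x \<in> Bij (carrier (G Mod N))" if "x \<in> carrier G" for x
      using bij[OF that] by (auto simp: Bij_def coset_action_def)
    ultimately show "coset_action G N (g \<otimes>\<^bsub>G\<^esub> h) =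
        coset_action G N g \<otimes>\<^bsub>BijGroup (carrier (G Mod N))\<^esub> coset_action G N h"
      using gh by (simp add: BijGroup_def)
  qed
qed

end

theory Submission
  imports Defs
begin

text \<open>
  The character \<open>\<Pi>\<close> equals \<open>d = |G/N|\<close> on \<open>N\<close> and \<open>0\<close> elsewhere, so \<open>\<psi>\<^sup>n(m\<Pi>)(g)\<close> is \<open>md\<close> if
  \<open>O\<^sub>N(g)\<close> divides \<open>n\<close> and \<open>0\<close> otherwise. At each \<open>g\<close> the equation defining \<open>\<lambda>\<^sub>t\<close> is therefore a
  geometric series equated with a logarithmic derivative, and the binomial series solves it.
  Since \<open>O\<^sub>N(g\<inverse>) = O\<^sub>N(g)\<close>, the inner products can be read off. If \<open>n\<close> is prime to \<open>d\<close>, a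
  series in \<open>t\<close> to the power \<open>O\<^sub>N(g)\<close> has zero \<open>n\<close>-th coefficient unless \<open>O\<^sub>N(g) = 1\<close>, that is, \<open>g \<in> N\<close>.
\<close>

section \<open>Power series in a monomial: coefficients, geometric series, binomial series\<close>

lemma fps_uminus_X_power: "(- fps_X :: 'a::comm_ring_1 fps) ^ k = fps_const ((- 1) ^ k) * fps_X ^ k"
proof -
  have "(- fps_X :: 'a fps) = fps_const (- 1) * fps_X"
    by (simp flip: fps_const_neg)
  then show ?thesis
    by (metis power_mult_distrib fps_const_power)
qed

lemma fps_compose_uminus_X_nth:
  "fps_nth (F oo - fps_X) n = (- 1) ^ n * fps_nth (F :: 'a::comm_ring_1 fps) n"
proof -
  have "fps_nth F i * fps_nth ((- fps_X) ^ i) n = (if i = n then (- 1) ^ n * fps_nth F n else 0)" for i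
    by (simp add: fps_uminus_X_power mult.commute)
  then show ?thesis by (simp add: fps_compose_nth)
qed

text \<open>Powers of the monomial only involve exponents \<open>k * i\<close>. The scalar
  \<open>c\<close> covers both \<open>- (fps_X ^ k)\<close> and
  \<open>- ((- fps_X) ^ k)\<close>.\<close>

lemma fps_compose_monom_nth_eq_0:
  fixes F :: "'a::comm_ring_1 fps"
  assumes "\<not> k dvd n"
  shows "fps_nth (F oo (fps_const c * fps_X ^ k)) n = 0"
proof -
  have "fps_nth ((fps_const c * fps_X ^ k) ^ i) n = 0" for i
  proof -
    have "(fps_const c * fps_X ^ k) ^ i = fps_const (c ^ i) * fps_X ^ (k * i)"
      by (simp add: power_mult_distrib power_mult)
    moreover have "n \<noteq> k * i" using assms by auto
    ultimately show ?thesis by (simp add: fps_X_power_nth)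
  qed
  then show ?thesis by (simp add: fps_compose_nth)
qed

lemma fps_compose_uminus_X_power_nth_eq_0:
  fixes F :: "'a::comm_ring_1 fps"
  assumes "\<not> k dvd n"
  shows "fps_nth (F oo - (fps_X ^ k)) n = 0"
  using fps_compose_monom_nth_eq_0[OF assms, of F "- 1"] by (simp flip: fps_const_neg)

lemma fps_compose_uminus_uminus_X_power_nth_eq_0:
  fixes F :: "'a::comm_ring_1 fps"
  assumes "\<not> k dvd n"
  shows "fps_nth (F oo - ((- fps_X) ^ k)) n = 0"
  using fps_compose_monom_nth_eq_0[OF assms, of F "- ((- 1) ^ k)"]
  by (simp add: fps_uminus_X_power flip: fps_const_neg)

text \<open>The second factor is the Adams series at a group element whose n-th power has value
  \<open>c\<close> or 0 according to whether \<open>k\<close> divides n. It is \<open>c\<close>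
  times the sum of \<open>(- fps_X) ^ (k * j)\<close> over j \<ge> 1; multiplying by the denominator
  avoids a quotient of series.\<close>

lemma one_minus_power_mult_geometric:
  fixes c :: "'a::comm_ring_1"
  assumes "k > 0"
  shows "(1 - (- fps_X) ^ k) * Abs_fps (\<lambda>n. if n = 0 then 0 else (- 1) ^ n * (if k dvd n then c else 0))
           = fps_const c * (- fps_X) ^ k"
    (is "_ * ?A = _")
proof (rule fps_ext)
  fix n
  \<comment> \<open>Writing a_n for the coefficients of \<open>?A\<close>, coefficient n of the
    product is a_n - (-1)^k a_(n-k), with the second term only for k \<le> n. These facts cancel it
    except at n = k, where a_0 is 0 instead of \<open>c\<close>.\<close>
  have "(- 1 :: 'a) ^ k * (- 1) ^ (n - k) = (- 1) ^ n" if "k \<le> n"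
    using that by (metis le_add_diff_inverse power_add)
  moreover have "k dvd n - k \<longleftrightarrow> k dvd n" if "k \<le> n"
    using that by (simp add: dvd_minus_self)
  moreover have "n < k \<Longrightarrow> k dvd n \<Longrightarrow> n = 0"
    using nat_dvd_not_less by blast
  ultimately show "fps_nth ((1 - (- fps_X) ^ k) * ?A) n = fps_nth (fps_const c * (- fps_X) ^ k) n"
    using assms
    by (auto simp: fps_uminus_X_power fps_X_power_mult_nth left_diff_distrib
        mult.assoc mult.left_commute[of _ c] mult.commute[of _ c])
qed

text \<open>The logarithmic derivative side of the equation defining the lambda series. With u =
  -(-X)^k and l = (1+u)^c, one has (1+u) l' = c l u' and -X u' = k (-X)^k. Taking c/k for c gives
  the same right-hand side as \<open>one_minus_power_mult_geometric\<close>.\<close>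

lemma fps_binomial_compose_log_deriv:
  fixes c :: complex
  assumes "k > 0"
  defines "l \<equiv> fps_binomial c oo - ((- fps_X) ^ k)"
  shows "(1 - (- fps_X) ^ k) * (- fps_X * fps_deriv l * inverse l) =
           fps_const (c * of_nat k) * (- fps_X) ^ k"
proof -
  define u :: "complex fps" where "u = - ((- fps_X) ^ k)"
  have u0: "fps_nth u 0 = 0" using assms by (simp add: u_def)
  have l0: "fps_nth l 0 = 1" by (simp add: l_def fps_compose_nth)
  have inv: "l * inverse l = 1" using l0 by (simp add: inverse_mult_eq_1')
  have Xu: "- fps_X * fps_deriv u = fps_const (of_nat k) * (- fps_X) ^ k"
  proof -
    obtain j where k: "k = Suc j" using assms(1) by (cases k) auto
    have "fps_deriv u = fps_const (of_nat k) * (- fps_X) ^ j"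
      unfolding u_def fps_deriv_neg fps_deriv_power by (simp add: k del: of_nat_Suc fps_const_neg)
    then show ?thesis unfolding k power_Suc by (simp only: mult_ac)
  qed
  \<comment> \<open>The differential equation of the binomial series; substituting \<open>u\<close>
    respects products because \<open>u\<close> has zero constant term.\<close>
  have "(1 + fps_X) * fps_deriv (fps_binomial c) = fps_const c * fps_binomial c"
    by (simp add: fps_binomial_deriv fps_divide_unit inverse_mult_eq_1'
        mult.left_commute[of "1 + fps_X"])
  then have "((1 + fps_X) * fps_deriv (fps_binomial c)) oo u = (fps_const c * fps_binomial c) oo u"
    by simp
  then have "(1 + u) * (fps_deriv (fps_binomial c) oo u) = fps_const c * l"
    using u0 by (simp add: fps_compose_mult_distrib fps_compose_add_distrib l_def u_def)
  moreover have "fps_deriv l = (fps_deriv (fps_binomial c) oo u) * fps_deriv u"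
    using u0 by (simp add: l_def u_def fps_compose_deriv)
  ultimately have *: "(1 + u) * fps_deriv l = fps_const c * l * fps_deriv u"
    by (simp flip: mult.assoc)
  have "(1 + u) * (- fps_X * fps_deriv l * inverse l) = - fps_X * inverse l * ((1 + u) * fps_deriv l)"
    by (simp only: mult_ac)
  also have "\<dots> = - fps_X * inverse l * (fps_const c * l * fps_deriv u)"
    by (simp only: *)
  also have "\<dots> = fps_const c * (- fps_X * fps_deriv u) * (l * inverse l)"
    by (simp only: mult_ac)
  also have "\<dots> = fps_const (c * of_nat k) * (- fps_X) ^ k"
    by (simp only: inv Xu mult_1_right mult.assoc[symmetric] fps_const_mult)
  finally show ?thesis by (simp only: u_def add_uminus_conv_diff)
qed

section \<open>Lambda and symmetric series computed one group element at a time\<close>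

lemma lambda_seriesI:
  assumes "L \<in> series_on G" "fps_nth L 0 = indicator (carrier G)"
    and "\<And>g. g \<in> carrier G \<Longrightarrow> series_at (adams_series G f) g =
           - fps_X * fps_deriv (series_at L g) * inverse (series_at L g)"
  shows "lambda_series G f = L"
proof -
  have "adams_series G f = - fps_X * fps_deriv L * series_inverse G L"
  proof (rule series_at_eqI)
    fix g
    \<comment> \<open>Off the carrier both sides vanish; on it the equation is the hypothesis,
      \<open>series_inverse\<close> being the pointwise inverse there.\<close>
    have "series_at (adams_series G f) g = 0" if "g \<notin> carrier G"
      using that by (intro fps_ext) (auto simp: adams_series_def adams_def)
    then show "series_at (adams_series G f) g =
        series_at (- fps_X * fps_deriv L * series_inverse G L) g"
      using assms
      by (cases "g \<in> carrier G")
         (simp_all add: series_at_mult series_at_uminus series_at_X series_at_deriv series_at_inverse)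
  qed
  then show ?thesis
    unfolding lambda_series_def using assms(1,2) lambda_series_ex1[of G f]
    by (intro the1_equality) auto
qed

lemma minus_one_power_fun_apply: "((- 1) ^ n :: 'a \<Rightarrow> 'b::ring_1) x = (- 1) ^ n"
  by (induction n) auto

lemma series_at_compose_uminus_X: "series_at (F oo - fps_X) g = series_at F g oo - fps_X"
proof (rule fps_ext)
  fix n
  show "fps_nth (series_at (F oo - fps_X) g) n = fps_nth (series_at F g oo - fps_X) n"
    by (simp add: fps_compose_uminus_X_nth minus_one_power_fun_apply)
qed

lemma series_at_adams_series:
  assumes "g \<in> carrier G"
  shows "series_at (adams_series G f) g =
    Abs_fps (\<lambda>n. if n = 0 then 0 else (- 1) ^ n * f (g [^]\<^bsub>G\<^esub> n))"
proof (rule fps_ext)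
  fix n
  show "fps_nth (series_at (adams_series G f) g) n =
      fps_nth (Abs_fps (\<lambda>n. if n = 0 then 0 else (- 1) ^ n * f (g [^]\<^bsub>G\<^esub> n))) n"
    using assms by (simp add: adams_series_def adams_def minus_one_power_fun_apply)
qed

text \<open>Extracts what matters about m\<Pi>: along the powers of g it takes a fixed value at
  multiples of \<open>k g\<close> and 0 elsewhere. It is applied with \<open>k\<close> the order in
  G/N and \<open>c\<close> equal to m|G/N|.\<close>

lemma lambda_symmetric_series_periodic:
  fixes c :: complex
  assumes "\<And>g. g \<in> carrier G \<Longrightarrow> k g > 0"
    and f: "\<And>g n. g \<in> carrier G \<Longrightarrow> f (g [^]\<^bsub>G\<^esub> (n::nat)) = (if k g dvd n then c else 0)"
    and g: "g \<in> carrier G"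
  shows "series_at (lambda_series G f) g = fps_binomial (c / of_nat (k g)) oo - ((- fps_X) ^ k g)"
      (is ?lam)
    and "series_at (symmetric_series G f) g = fps_binomial (- (c / of_nat (k g))) oo - (fps_X ^ k g)"
      (is ?sym)
proof -
  \<comment> \<open>The expected series at each element, assembled into one series over functions
    that vanish off the carrier.\<close>
  define l where "l h = fps_binomial (c / of_nat (k h)) oo - ((- fps_X) ^ k h)" for h
  define L where "L = Abs_fps (\<lambda>i h. if h \<in> carrier G then fps_nth (l h) i else 0)"
  have l0: "fps_nth (l h) 0 = 1" for h by (simp add: l_def fps_compose_nth)
  have L: "series_at L h = (if h \<in> carrier G then l h else 0)" for h
    by (rule fps_ext) (simp add: L_def)
  have L_on: "L \<in> series_on G" and L0: "fps_nth L 0 = indicator (carrier G)"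
    by (auto simp: series_on_iff L) (auto simp: L_def l0 indicator_def fun_eq_iff)
  have lam: "lambda_series G f = L"
  proof (rule lambda_seriesI[OF L_on L0])
    fix h assume h: "h \<in> carrier G"
    have k: "k h > 0" using assms(1) h .
    have A: "series_at (adams_series G f) h =
        Abs_fps (\<lambda>n. if n = 0 then 0 else (- 1) ^ n * (if k h dvd n then c else 0))"
      using h by (simp add: series_at_adams_series f cong: if_cong)
    \<comment> \<open>Both products equal c(-X)^(k h). The common factor cancels because its
      constant coefficient is 1, as \<open>k h > 0\<close>.\<close>
    have "(1 - (- fps_X) ^ k h) * series_at (adams_series G f) h =
        (1 - (- fps_X) ^ k h) * (- fps_X * fps_deriv (l h) * inverse (l h))"
      using one_minus_power_mult_geometric[OF k, of c]
        fps_binomial_compose_log_deriv[OF k, of "c / of_nat (k h)"] k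
      by (simp add: A l_def)
    moreover have "(1 - (- fps_X) ^ k h :: complex fps) \<noteq> 0"
      using k by (intro fps_nonzeroI[of _ 0]) (simp add: fps_uminus_X_power)
    ultimately have "series_at (adams_series G f) h = - fps_X * fps_deriv (l h) * inverse (l h)"
      using mult_left_cancel by blast
    then show "series_at (adams_series G f) h =
        - fps_X * fps_deriv (series_at L h) * inverse (series_at L h)"
      using h L by simp
  qed
  then show ?lam using g by (simp add: L l_def)
  have "L oo - fps_X \<in> series_on G"
    by (simp add: series_on_iff series_at_compose_uminus_X L)
  moreover have "fps_nth (L oo - fps_X) 0 = indicator (carrier G)"
    by (simp add: fps_compose_uminus_X_nth L0)
  ultimately have "series_at (symmetric_series G f) g = inverse (series_at (L oo - fps_X) g)"
    using g by (simp add: symmetric_series_def lam series_at_inverse)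
  \<comment> \<open>Replacing X by -X turns -(-X)^k into -X^k; positivity of \<open>k g\<close>
    gives the zero constant term that makes composition associative. Inversion then negates the
    binomial exponent.\<close>
  also have "series_at (L oo - fps_X) g = fps_binomial (c / of_nat (k g)) oo (- ((- fps_X) ^ k g) oo - fps_X)"
    using g assms(1) by (simp add: series_at_compose_uminus_X L l_def fps_compose_assoc)
  also have "- ((- fps_X) ^ k g) oo - fps_X = (- (fps_X ^ k g) :: complex fps)"
    by (simp add: fps_compose_uminus flip: fps_compose_power)
  also have "inverse (fps_binomial (c / of_nat (k g)) oo - (fps_X ^ k g)) =
      inverse (fps_binomial (c / of_nat (k g))) oo - (fps_X ^ k g)"
    using g assms(1) by (simp add: fps_inverse_compose)
  also have "inverse (fps_binomial (c / of_nat (k g))) = fps_binomial (- (c / of_nat (k g)))"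
    by (simp add: fps_inverse_unique flip: fps_binomial_add_mult)
  finally show ?sym .
qed

section \<open>The permutation character of G on G/N\<close>

lemma coset_action_fixed_iff:
  assumes "N \<lhd> G" "g \<in> carrier G" "C \<in> carrier (G Mod N)"
  shows "coset_action G N g C = C \<longleftrightarrow> N #>\<^bsub>G\<^esub> g = \<one>\<^bsub>G Mod N\<^esub>"
proof -
  interpret normal N G by fact
  interpret Q: group "G Mod N" by (rule factorgroup_is_group)
  from assms(3) obtain a where a: "a \<in> carrier G" "C = N #>\<^bsub>G\<^esub> a"
    by (auto simp: FactGroup_def RCOSETS_def)
  \<comment> \<open>Since gN = Ng, translation by g is left multiplication by Ng in G/N, and by
    cancellation it fixes a coset only if Ng is the identity.\<close>
  have "g <#\<^bsub>G\<^esub> C = (g <#\<^bsub>G\<^esub> N) #>\<^bsub>G\<^esub> a"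
    using a assms(2) subset by (auto simp: l_coset_def r_coset_def m_assoc)
  also have "\<dots> = (N #>\<^bsub>G\<^esub> g) \<otimes>\<^bsub>G Mod N\<^esub> C"
    using a assms(2) subset bspec[OF coset_eq assms(2), symmetric]
    by (simp add: FactGroup_def rcos_sum coset_mult_assoc)
  finally have "coset_action G N g C = (N #>\<^bsub>G\<^esub> g) \<otimes>\<^bsub>G Mod N\<^esub> C"
    using assms(3) by (simp add: coset_action_def)
  moreover have "N #>\<^bsub>G\<^esub> g \<in> carrier (G Mod N)"
    using assms(2) by (auto simp: FactGroup_def RCOSETS_def)
  ultimately show ?thesis
    using assms(3) Q.r_cancel_one by metis
qed

text \<open>The trace counts the fixed cosets, and g fixes either all of them or none.\<close>

lemma coset_permutation_character:
  assumes "N \<lhd> G" "bij_betw e {..<d} (carrier (G Mod N))" "g \<in> carrier G"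
  shows "rep_character G (permutation_rep d e (coset_action G N)) g =
    (if N #>\<^bsub>G\<^esub> g = \<one>\<^bsub>G Mod N\<^esub> then of_nat d else 0)"
proof -
  have "e i \<in> carrier (G Mod N)" if "i < d" for i
    using that assms(2) by (auto simp: bij_betw_def)
  then show ?thesis
    using coset_action_fixed_iff[OF assms(1,3)] assms(3)
    by (simp add: rep_character_def permutation_rep_def)
qed

section \<open>The case of m\<Pi>: series, inner products, and degrees prime to |G/N|\<close>

theorem theorem5p4p5:
  fixes G :: "('a, 'b) monoid_scheme" (structure) and N :: "'a set" and m :: nat and e :: "nat \<Rightarrow> 'a set"
    and \<pi> :: "'a \<Rightarrow> complex" and ON :: "'a \<Rightarrow> nat" and d :: nat
  assumes "group G" and "finite (carrier G)" and "N \<lhd> G" and "m \<ge> 1"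
  defines "d \<equiv> card (carrier (G Mod N))"
  assumes "bij_betw e {..<d} (carrier (G Mod N))"
  defines "\<pi> \<equiv> rep_character G (permutation_rep d e (coset_action G N))"
    and "ON \<equiv> \<lambda>g. group.ord (G Mod N) (N #> g)"
  shows
    "(\<forall>g \<in> carrier G.
        series_at (lambda_series G (\<lambda>x. of_nat m * \<pi> x)) g =
          fps_binomial (of_nat (m * d) / of_nat (ON g)) oo (- ((- fps_X) ^ ON g)) \<and>
        series_at (symmetric_series G (\<lambda>x. of_nat m * \<pi> x)) g =
          fps_binomial (- (of_nat (m * d) / of_nat (ON g))) oo (- (fps_X ^ ON g)))
     \<and>
     (\<forall>\<chi> \<in> irreducible_characters G.
        series_inner G \<chi> (symmetric_series G (\<lambda>x. of_nat m * \<pi> x)) =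
          fps_const (1 / of_nat (card (carrier G))) *
            (\<Sum>g \<in> carrier G. fps_const (\<chi> g) *
               (fps_binomial (- (of_nat (m * d) / of_nat (ON g))) oo (- (fps_X ^ ON g)))) \<and>
        series_inner G \<chi> (lambda_series G (\<lambda>x. of_nat m * \<pi> x)) =
          fps_const (1 / of_nat (card (carrier G))) *
            (\<Sum>g \<in> carrier G. fps_const (\<chi> g) *
               (fps_binomial (of_nat (m * d) / of_nat (ON g)) oo (- ((- fps_X) ^ ON g)))))
     \<and>
     (\<forall>n :: nat. n \<ge> 1 \<longrightarrow> gcd n d = 1 \<longrightarrow>
        symmetric_op G n (\<lambda>x. of_nat m * \<pi> x) =
          (\<lambda>x. 1 / of_nat d * of_nat ((m * d + n - 1) choose n) * \<pi> x) \<and>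
        lambda_op G n (\<lambda>x. of_nat m * \<pi> x) =
          (\<lambda>x. 1 / of_nat d * of_nat ((m * d) choose n) * \<pi> x))"
proof -
  interpret normal N G by fact
  interpret Q: group "G Mod N" by (rule factorgroup_is_group)
  define f where "f = (\<lambda>x. of_nat m * \<pi> x)"
  have fin: "finite (carrier (G Mod N))"
    using \<open>finite (carrier G)\<close> by (auto simp: FactGroup_def RCOSETS_def)
  have Q_in: "N #> g \<in> carrier (G Mod N)" if "g \<in> carrier G" for g
    using that by (auto simp: FactGroup_def RCOSETS_def)
  have d_pos: "d > 0"
    unfolding d_def using fin Q.one_closed card_gt_0_iff by blast
  have ON_pos: "ON g > 0" if "g \<in> carrier G" for g
    unfolding ON_def using Q.ord_ge_1[OF fin Q_in[OF that]] by simp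
  have ON_dvd: "ON g dvd d" if "g \<in> carrier G" for g
    unfolding ON_def d_def using Q.ord_dvd_group_order[OF Q_in[OF that]] by (simp add: Coset.order_def)
  have ON_1_iff: "N #> g = \<one>\<^bsub>G Mod N\<^esub> \<longleftrightarrow> ON g = 1" if "g \<in> carrier G" for g
    unfolding ON_def using Q.ord_eq_1[OF Q_in[OF that]] by auto
  have hom: "group_hom G (G Mod N) (\<lambda>a. N #> a)"
    using r_coset_hom_Mod is_group Q.is_group by (simp add: group_hom_def group_hom_axioms_def)
  have \<pi>: "\<pi> g = (if N #> g = \<one>\<^bsub>G Mod N\<^esub> then of_nat d else 0)" if "g \<in> carrier G" for g
    unfolding \<pi>_def using coset_permutation_character[OF \<open>N \<lhd> G\<close> _ that] assms(6) by blast
  have \<pi>_out: "\<pi> g = 0" if "g \<notin> carrier G" for g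
    using that by (simp add: \<pi>_def rep_character_def)
  \<comment> \<open>\<Pi>(g^n) is nonzero exactly when (Ng)^n is trivial, that is, when the order of
    Ng divides n.\<close>
  have "f (g [^] n) = (if ON g dvd n then of_nat (m * d) else 0)" if "g \<in> carrier G" for g and n :: nat
  proof -
    have "N #> (g [^] n) = (N #> g) [^]\<^bsub>G Mod N\<^esub> n"
      using group_hom.hom_nat_pow[OF hom that] .
    then show ?thesis
      using that Q.pow_eq_id[OF Q_in[OF that]] by (simp add: f_def \<pi> ON_def)
  qed
  note series = lambda_symmetric_series_periodic[of G ON f, OF ON_pos this]
  have lam: "series_at (lambda_series G f) g =
      fps_binomial (of_nat (m * d) / of_nat (ON g)) oo (- ((- fps_X) ^ ON g))"
    and sym: "series_at (symmetric_series G f) g =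
      fps_binomial (- (of_nat (m * d) / of_nat (ON g))) oo (- (fps_X ^ ON g))"
    if "g \<in> carrier G" for g
    using series that by blast+
  have ON_inv: "ON (inv g) = ON g" if "g \<in> carrier G" for g
    unfolding ON_def
    using group_hom.hom_inv[OF hom that] Q.ord_inv[OF Q_in[OF that]] by simp
  \<comment> \<open>The inner product evaluates F at the inverse of g. As F depends on g only
    through \<open>ON g\<close>, \<open>ON_inv\<close> allows g in its place.\<close>
  have inner: "series_inner G \<chi> F =
      fps_const (1 / of_nat (card (carrier G))) * (\<Sum>g \<in> carrier G. fps_const (\<chi> g) * H (ON g))"
    if "\<And>g. g \<in> carrier G \<Longrightarrow> series_at F g = H (ON g)" for \<chi> F and H :: "nat \<Rightarrow> complex fps"
  proof (rule fps_ext)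
    fix n
    have "fps_nth F n (inv g) = fps_nth (H (ON g)) n" if "g \<in> carrier G" for g
      using that \<open>\<And>g. g \<in> carrier G \<Longrightarrow> series_at F g = H (ON g)\<close>[of "inv g"] ON_inv
      by (metis inv_closed series_at_nth)
    then show "fps_nth (series_inner G \<chi> F) n =
        fps_nth (fps_const (1 / of_nat (card (carrier G))) * (\<Sum>g \<in> carrier G. fps_const (\<chi> g) * H (ON g))) n"
      by (simp add: series_inner_def char_inner_def fps_sum_nth)
  qed
  \<comment> \<open>The operations are compared as functions on the whole type, so their values off
    the carrier are needed too.\<close>
  have S_on: "fps_nth (symmetric_series G f) n g = 0" and L_on: "fps_nth (lambda_series G f) n g = 0"
    if "g \<notin> carrier G" for g n
  proof -
    from theI'[OF lambda_series_ex1[of G f]]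
    have L: "lambda_series G f \<in> series_on G" "fps_nth (lambda_series G f) 0 = indicator (carrier G)"
      by (auto simp: lambda_series_def)
    then show "fps_nth (lambda_series G f) n g = 0"
      using that by (auto simp: series_on_def functions_on_def)
    have "lambda_series G f oo - fps_X \<in> series_on G"
      using L by (simp add: series_on_iff series_at_compose_uminus_X)
    moreover have "fps_nth (lambda_series G f oo - fps_X) 0 = indicator (carrier G)"
      using L by (simp add: fps_compose_uminus_X_nth)
    ultimately have "series_at (symmetric_series G f) g = 0"
      using that by (simp add: symmetric_series_def series_at_inverse)
    then show "fps_nth (symmetric_series G f) n g = 0"
      by (metis series_at_nth fps_zero_nth)
  qed
  have ops: "fps_nth (symmetric_series G f) n g = 1 / of_nat d * of_nat ((m * d + n - 1) choose n) * \<pi> g"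
      "fps_nth (lambda_series G f) n g = 1 / of_nat d * of_nat ((m * d) choose n) * \<pi> g"
    if n: "n \<ge> 1" "gcd n d = 1" for n g
  proof -
    consider "g \<notin> carrier G" | "g \<in> carrier G" "ON g = 1" | "g \<in> carrier G" "ON g \<noteq> 1" by blast
    then have "fps_nth (symmetric_series G f) n g = 1 / of_nat d * of_nat ((m * d + n - 1) choose n) * \<pi> g
        \<and> fps_nth (lambda_series G f) n g = 1 / of_nat d * of_nat ((m * d) choose n) * \<pi> g"
    proof cases
      case 1
      then show ?thesis by (simp add: S_on L_on \<pi>_out)
    next
      case 2
      \<comment> \<open>Here the series is (1-t)^(-md), and upper negation rewrites its coefficient.
        With n \<ge> 1 the natural subtraction in \<open>m * d + n - 1\<close> is exact.\<close>
      have "fps_nth (symmetric_series G f) n g = (- 1) ^ n * ((- of_nat (m * d)) gchoose n)"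
        using sym[OF 2(1)] 2(2) by (simp add: fps_compose_uminus_X_nth flip: series_at_nth)
      also have "\<dots> = (of_nat (m * d) + of_nat n - 1) gchoose n"
        by (simp only: gbinomial_minus mult.assoc[symmetric] minus_one_mult_self mult_1_left)
      also have "of_nat (m * d) + of_nat n - 1 = (of_nat (m * d + n - 1) :: complex)"
        using n by (simp add: of_nat_diff)
      finally have "fps_nth (symmetric_series G f) n g = of_nat ((m * d + n - 1) choose n)"
        by (simp only: binomial_gbinomial)
      \<comment> \<open>For order 1 the inner series -(-X) is X, which leaves (1+t)^(md).\<close>
      moreover have "fps_nth (lambda_series G f) n g = of_nat (m * d) gchoose n"
        using lam[OF 2(1)] 2(2) by (simp flip: series_at_nth)
      then have "fps_nth (lambda_series G f) n g = of_nat ((m * d) choose n)"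
        by (simp only: binomial_gbinomial)
      moreover have "\<pi> g = of_nat d" using 2 ON_1_iff \<pi> by simp
      ultimately show ?thesis using d_pos by simp
    next
      case 3
      \<comment> \<open>\<open>ON g\<close> divides \<open>d\<close>; if it also divided n, it would
        divide their gcd 1. So both coefficients vanish, as does \<Pi>(g).\<close>
      have "\<not> ON g dvd n"
        using n(2) ON_dvd[OF 3(1)] 3(2) by (metis gcd_greatest nat_dvd_1_iff_1)
      then show ?thesis
        using 3 lam[OF 3(1)] sym[OF 3(1)] ON_1_iff \<pi>
        by (simp add: fps_compose_uminus_X_power_nth_eq_0 fps_compose_uminus_uminus_X_power_nth_eq_0
            flip: series_at_nth)
    qed
    then show "fps_nth (symmetric_series G f) n g = 1 / of_nat d * of_nat ((m * d + n - 1) choose n) * \<pi> g"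
      "fps_nth (lambda_series G f) n g = 1 / of_nat d * of_nat ((m * d) choose n) * \<pi> g" by blast+
  qed
  note inner_sym = inner[where H = "\<lambda>k. fps_binomial (- (of_nat (m * d) / of_nat k)) oo (- (fps_X ^ k))", OF sym]
  note inner_lam = inner[where H = "\<lambda>k. fps_binomial (of_nat (m * d) / of_nat k) oo (- ((- fps_X) ^ k))", OF lam]
  show ?thesis
    unfolding f_def[symmetric] symmetric_op_def lambda_op_def
    by (intro conjI ballI allI impI ext lam sym inner_sym inner_lam ops)
qed

end
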